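(* Let $q$ be a prime power and let $n\le m$ be positive integers. An $[n,k,d]_{q^m/q}$ MRD code is rank-metric intersecting if and only if $2d>n$.
   Context: Support and rank: fix an $\mathbb{F}_q$-basis $\Gamma$ of $\mathbb{F}_{q^m}$. For $x=(x_1,\dots,x_n)\in\mathbb{F}_{q^m}^n$ let $\mathrm{Mat}_\Gamma(x)\in\mathbb{F}_q^{m\times n}$ be the matrix whose $j$-th column is the coordinate vector of $x_j$ in the basis $\Gamma$. The support $\sigma(x)\subseteq\mathbb{F}_q^n$ is the $\mathbb{F}_q$-row space of $\mathrm{Mat}_\Gamma(x)$, and $\mathrm{rk}(x)=\dim_{\mathbb{F}_q}\sigma(x)$; both are independent of $\Gamma$. An $[n,k,d]_{q^m/q}$ code is an $\mathbb{F}_{q^m}$-linear subspace $\mathcal{C}$ of $\mathbb{F}_{q^m}^n$ with $k=\dim_{\mathbb{F}_{q^m}}\mathcal{C}\ge 1$ and minimum distance $d=\min_{c\in\mathcal{C}\setminus\{0\}}\mathrm{rk}(c)$. It is an MRD code if it attains equality in the Singleton bound $km\le\max(m,n)(\min(m,n)-d+1)$; for $n\le m$ this means $d=n-k+1$. The code is rank-metric intersecting if $\sigma(c)\cap\sigma(c')\ne\{0\}$ for all $c,c'\in\mathcal{C}\setminus\{0\}$. *)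

theory Defs
  imports "HOL-Analysis.Analysis"
begin

text \<open>
  The extension of finite fields is given by a ring homomorphism (necessarily injective)
  \<open>h\<close> from the small field \<^typ>\<open>'k\<close> to the large field \<^typ>\<open>'l\<close>. The degree of the
  extension is \<open>CARD('m)\<close>, where \<^typ>\<open>'m\<close> is the index type of a basis, and the length of
  the codes is \<open>CARD('n)\<close>.
\<close>

definition field_embedding :: "('k::field \<Rightarrow> 'l::field) \<Rightarrow> bool" where
  "field_embedding h \<longleftrightarrow>
     h 1 = 1 \<and> (\<forall>x y. h (x + y) = h x + h y) \<and> (\<forall>x y. h (x * y) = h x * h y)"

definition ext_scale :: "('k::field \<Rightarrow> 'l::field) \<Rightarrow> 'k \<Rightarrow> 'l \<Rightarrow> 'l" where
  "ext_scale h a x = h a * x"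

lemma vector_space_ext_scale:
  assumes "field_embedding h"
  shows "vector_space (ext_scale h)"
  using assms by unfold_locales (auto simp: field_embedding_def ext_scale_def algebra_simps)

definition extension_basis :: "('k::field \<Rightarrow> 'l::field) \<Rightarrow> ('m::finite \<Rightarrow> 'l) \<Rightarrow> bool" where
  "extension_basis h \<Gamma> \<longleftrightarrow>
     inj \<Gamma> \<and> \<not> module.dependent (ext_scale h) (range \<Gamma>)
     \<and> module.span (ext_scale h) (range \<Gamma>) = UNIV"

definition coord_matrix ::
    "('k::field \<Rightarrow> 'l::field) \<Rightarrow> ('m::finite \<Rightarrow> 'l) \<Rightarrow> 'l ^ 'n \<Rightarrow> 'k ^ 'n ^ 'm" where
  "coord_matrix h \<Gamma> x =
     (\<chi> i j. module.representation (ext_scale h) (range \<Gamma>) (x $ j) (\<Gamma> i))"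

definition rk_support ::
    "('k::field \<Rightarrow> 'l::field) \<Rightarrow> ('m::finite \<Rightarrow> 'l) \<Rightarrow> 'l ^ 'n \<Rightarrow> ('k ^ 'n) set" where
  "rk_support h \<Gamma> x = vec.span (rows (coord_matrix h \<Gamma> x))"

definition rk :: "('k::field \<Rightarrow> 'l::field) \<Rightarrow> ('m::finite \<Rightarrow> 'l) \<Rightarrow> 'l ^ 'n \<Rightarrow> nat" where
  "rk h \<Gamma> x = vec.dim (rk_support h \<Gamma> x)"

text \<open>
  The set of ranks below is finite, and it is nonempty for a code of dimension \<open>k \<ge> 1\<close>.
\<close>

definition min_distance ::
    "('k::field \<Rightarrow> 'l::field) \<Rightarrow> ('m::finite \<Rightarrow> 'l) \<Rightarrow> ('l ^ 'n) set \<Rightarrow> nat" where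
  "min_distance h \<Gamma> C = Min (rk h \<Gamma> ` (C - {0}))"

definition rank_metric_code ::
    "('k::field \<Rightarrow> 'l::field) \<Rightarrow> ('m::finite \<Rightarrow> 'l) \<Rightarrow> nat \<Rightarrow> nat \<Rightarrow> ('l ^ 'n) set \<Rightarrow> bool" where
  "rank_metric_code h \<Gamma> k d C \<longleftrightarrow>
     vec.subspace C \<and> vec.dim C = k \<and> k \<ge> 1 \<and> min_distance h \<Gamma> C = d"

text \<open>
  Equality in the Singleton bound. The subtraction is exact, since \<open>d\<close> is the rank of an
  \<open>m \<times> n\<close> matrix and hence at most \<open>min m n\<close>.
\<close>

definition MRD_code ::
    "('k::field \<Rightarrow> 'l::field) \<Rightarrow> ('m::finite \<Rightarrow> 'l) \<Rightarrow> nat \<Rightarrow> nat \<Rightarrow> ('l ^ 'n) set \<Rightarrow> bool" where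
  "MRD_code h \<Gamma> k d C \<longleftrightarrow>
     rank_metric_code h \<Gamma> k d C \<and>
     k * CARD('m) = max CARD('m) CARD('n) * (min CARD('m) CARD('n) - d + 1)"

definition rank_metric_intersecting ::
    "('k::field \<Rightarrow> 'l::field) \<Rightarrow> ('m::finite \<Rightarrow> 'l) \<Rightarrow> ('l ^ 'n) set \<Rightarrow> bool" where
  "rank_metric_intersecting h \<Gamma> C \<longleftrightarrow>
     (\<forall>c \<in> C - {0}. \<forall>c' \<in> C - {0}. rk_support h \<Gamma> c \<inter> rk_support h \<Gamma> c' \<noteq> {0})"

end

theory Submission
  imports Defs
begin

text \<open>
  For \<open>n \<le> m\<close> the MRD condition says \<open>k = n - d + 1\<close>. If \<open>2 d > n\<close>, two supports of dimension at
  least \<open>d\<close> cannot meet trivially in a space of dimension \<open>n\<close>. If \<open>2 d \<le> n\<close>, choose disjoint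
  coordinate sets \<open>A\<close>, \<open>B\<close> of size \<open>d\<close>: since \<open>k + d > n\<close>, the code contains nonzero words that
  vanish outside \<open>A\<close> and outside \<open>B\<close>, and the supports of these words lie in complementary
  coordinate subspaces.
\<close>

lemma subspace_coordinate: "vec.subspace {x :: 'a::field ^ 'n. \<forall>j. j \<notin> A \<longrightarrow> x $ j = 0}"
  by (auto simp: vec.subspace_def)

text \<open>By the dimension formula for sums, a trivial intersection would force
  \<open>S + T\<close> to have dimension above \<open>CARD('n)\<close>. The lemma serves twice: over
  \<open>'l\<close> for a code and a coordinate subspace, over \<open>'k\<close> for two
  supports.\<close>

lemma subspaces_meet_nontrivially:
  fixes S T :: "('a::field ^ 'n) set"
  assumes "vec.subspace S" "vec.subspace T" and "CARD('n) < vec.dim S + vec.dim T"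
  shows "S \<inter> T \<noteq> {0}"
proof
  assume "S \<inter> T = {0}"
  then have "vec.dim (S \<inter> T) = 0" by simp
  moreover have "vec.dim {x + y |x y. x \<in> S \<and> y \<in> T} + vec.dim (S \<inter> T) = vec.dim S + vec.dim T"
    using assms(1,2) by (rule vec.dim_sums_Int)
  moreover have "vec.dim {x + y |x y. x \<in> S \<and> y \<in> T} \<le> CARD('n)"
    by (rule dim_subset_UNIV_cart_gen)
  ultimately show False using assms(3) by linarith
qed

text \<open>The vectors vanishing outside \<open>A\<close> form a subspace of dimension
  \<open>card A\<close>, which is too large to meet \<open>C\<close> trivially.\<close>

lemma exists_nonzero_vanishing_outside:
  fixes C :: "('a::field ^ 'n) set"
  assumes "vec.subspace C" and "CARD('n) < vec.dim C + card A"
  shows "\<exists>c \<in> C - {0}. \<forall>j. j \<notin> A \<longrightarrow> c $ j = 0"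
proof -
  let ?V = "{x :: 'a ^ 'n. \<forall>j. j \<notin> A \<longrightarrow> x $ j = 0}"
  have "C \<inter> ?V \<noteq> {0}"
    using assms subspace_coordinate by (intro subspaces_meet_nontrivially) (simp_all add: dim_substandard_cart)
  moreover have "0 \<in> C \<inter> ?V"
    using assms(1) by (simp add: vec.subspace_0)
  ultimately show ?thesis by blast
qed

text \<open>A zero entry of \<open>x\<close> has zero coordinates, hence gives a zero column of the
  matrix; all rows, and so their span, vanish there.\<close>

lemma rk_support_vanishes_outside:
  fixes x :: "'l::field ^ 'n"
  assumes "field_embedding h" and "\<forall>j. j \<notin> A \<longrightarrow> x $ j = 0" and "v \<in> rk_support h \<Gamma> x"
  shows "\<forall>j. j \<notin> A \<longrightarrow> v $ j = 0"
proof -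
  interpret vector_space "ext_scale h" using assms(1) by (rule vector_space_ext_scale)
  have "rows (coord_matrix h \<Gamma> x) \<subseteq> {v. \<forall>j. j \<notin> A \<longrightarrow> v $ j = 0}"
    using assms(2) by (auto simp: rows_def row_def coord_matrix_def representation_zero)
  then have "rk_support h \<Gamma> x \<subseteq> {v. \<forall>j. j \<notin> A \<longrightarrow> v $ j = 0}"
    unfolding rk_support_def by (intro vec.span_minimal subspace_coordinate)
  with assms(3) show ?thesis by blast
qed

lemma min_distance_le_rk:
  fixes C :: "('l::{field,finite} ^ 'n) set"
  assumes "c \<in> C - {0}"
  shows "min_distance h \<Gamma> C \<le> rk h \<Gamma> c"
  unfolding min_distance_def using assms by (intro Min_le) auto

theorem proposition2p8:
  fixes h :: "'k::{field,finite} \<Rightarrow> 'l::{field,finite}"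
    and \<Gamma> :: "'m::finite \<Rightarrow> 'l"
    and C :: "('l ^ 'n) set"
    and q k d :: nat
  assumes "CARD('k) = q"
    and "CARD('l) = q ^ CARD('m)"
    and "field_embedding h"
    and "extension_basis h \<Gamma>"
    and "CARD('n) \<le> CARD('m)"
    and "MRD_code h \<Gamma> k d C"
  shows "rank_metric_intersecting h \<Gamma> C \<longleftrightarrow> 2 * d > CARD('n)"
proof
  have C: "vec.subspace C" and dim_C: "vec.dim C = k" and d: "min_distance h \<Gamma> C = d"
    using assms(6) by (auto simp: MRD_code_def rank_metric_code_def)
  have "k * CARD('m) = (CARD('n) - d + 1) * CARD('m)"
    using assms(5,6) by (simp add: MRD_code_def max_def min_def mult.commute)
  \<comment> \<open>Where this is used, \<open>2 * d \<le> CARD('n)\<close>, so the subtraction is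
    exact and \<open>k + d = CARD('n) + 1\<close>, just enough for nonzero words supported on
    \<open>d\<close> coordinates.\<close>
  then have k: "k = CARD('n) - d + 1" by (metis mult_cancel2 zero_less_card_finite less_irrefl)
  show "2 * d > CARD('n)" if "rank_metric_intersecting h \<Gamma> C"
  proof (rule ccontr)
    assume "\<not> 2 * d > CARD('n)"
    then have le: "2 * d \<le> CARD('n)" by simp
    obtain A :: "'n set" where A: "card A = d"
      using obtain_subset_with_card_n[of d "UNIV :: 'n set"] le by auto
    have "d \<le> card (- A)" using le A by (simp add: Compl_eq_Diff_UNIV card_Diff_subset)
    then obtain B where B: "B \<subseteq> - A" "card B = d"
      using obtain_subset_with_card_n by metis
    obtain a where a: "a \<in> C - {0}" "\<forall>j. j \<notin> A \<longrightarrow> a $ j = 0"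
      using exists_nonzero_vanishing_outside[OF C, of A] A dim_C k le by auto
    obtain b where b: "b \<in> C - {0}" "\<forall>j. j \<notin> B \<longrightarrow> b $ j = 0"
      using exists_nonzero_vanishing_outside[OF C, of B] B dim_C k le by auto
    have "rk_support h \<Gamma> a \<inter> rk_support h \<Gamma> b \<subseteq> {0}"
    proof
      fix v assume v: "v \<in> rk_support h \<Gamma> a \<inter> rk_support h \<Gamma> b"
      \<comment> \<open>As \<open>A\<close> and \<open>B\<close> are disjoint, every
        \<open>j\<close> lies outside one of them.\<close>
      have "v $ j = 0" for j
        using rk_support_vanishes_outside[OF assms(3) a(2), of v \<Gamma>]
          rk_support_vanishes_outside[OF assms(3) b(2), of v \<Gamma>] v B(1) by blast
      then show "v \<in> {0}" by (simp add: vec_eq_iff)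
    qed
    moreover have "0 \<in> rk_support h \<Gamma> a \<inter> rk_support h \<Gamma> b"
      by (simp add: rk_support_def vec.span_zero)
    ultimately show False
      using that a(1) b(1) unfolding rank_metric_intersecting_def by blast
  qed
  show "rank_metric_intersecting h \<Gamma> C" if "2 * d > CARD('n)"
    unfolding rank_metric_intersecting_def
  proof (intro ballI subspaces_meet_nontrivially)
    \<comment> \<open>Both supports lie in the \<open>CARD('n)\<close>-dimensional space over
      \<open>'k\<close>, and their dimensions add up to at least \<open>2 * d\<close>.\<close>
    fix a b assume "a \<in> C - {0}" "b \<in> C - {0}"
    then have "d \<le> rk h \<Gamma> a" "d \<le> rk h \<Gamma> b"
      using min_distance_le_rk d by blast+
    with that show "CARD('n) < vec.dim (rk_support h \<Gamma> a) + vec.dim (rk_support h \<Gamma> b)"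
      by (simp add: rk_def)
  qed (simp_all add: rk_support_def vec.subspace_span)
qed

end
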